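(* Let $S$ be the multiset consisting of $4$ copies of each odd positive integer together with $4$ additional copies of each odd positive multiple of $5$, and let $T$ be the multiset consisting of $4$ copies of each even positive integer together with $4$ additional copies of each even positive multiple of $5$ (all copies distinct). Let $D_S(N)$ be the number of partitions of $N$ into distinct elements of $S$ having an odd number of parts, and $D_T(N)$ the number of partitions of $N$ into distinct elements of $T$. Then for every $N\ge 3$, $D_S(N)=8D_T(N-3)$.
   Context: A partition of $N$ into distinct elements of a multiset is a finite set of distinct elements of it (different copies of the same integer count as distinct elements) whose values sum to $N$. $D_T(0)=1$. *)

theory Defs
  imports Main
begin

text \<open>A multiset of positive integers is modelled by its set of labelled copies:
  a pair (n, i) is the i-th copy of the integer n.\<close>

definition S_elems :: "(nat \<times> nat) set" where
  "S_elems = {(n, i). n > 0 \<and> odd n \<and> (i < 4 \<or> (5 dvd n \<and> i < 8))}"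

definition T_elems :: "(nat \<times> nat) set" where
  "T_elems = {(n, i). n > 0 \<and> even n \<and> (i < 4 \<or> (5 dvd n \<and> i < 8))}"

definition distinct_partitions :: "(nat \<times> nat) set \<Rightarrow> nat \<Rightarrow> (nat \<times> nat) set set" where
  "distinct_partitions E N = {P. P \<subseteq> E \<and> finite P \<and> (\<Sum>x\<in>P. fst x) = N}"

definition D_S :: "nat \<Rightarrow> nat" where
  "D_S N = card {P \<in> distinct_partitions S_elems N. odd (card P)}"

definition D_T :: "nat \<Rightarrow> nat" where
  "D_T N = card (distinct_partitions T_elems N)"

end

theory Submission
  imports Defs "HOL-Computational_Algebra.Formal_Power_Series"
begin

text \<open>
  For $Q = q^d$ put $x_d = \prod (1 + Q^{2i+1})$, $y_d = \prod (1 - Q^{2i+1})$ and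
  $c_d = \prod (1 + Q^{2i+2})$, so that $x_d y_d c_d = 1$. The claim is the comparison of
  coefficients in $x_1^4 x_5^4 - y_1^4 y_5^4 = 8 q + 16 q^3 c_1^4 c_5^4$, a form of the modular
  equation of degree 5. This follows from two identities:
  \<^item> Jacobi's $x_d^8 = y_d^8 + 16 Q c_d^8$;
  \<^item> $c_1^2 x_5^2 - q x_1^2 c_5^2 = y_1 y_5$.

  Multiplying Jacobi's identities for $d = 1$ and $d = 5$ and eliminating the mixed terms
  $c_1^8 x_5^8$ and $x_1^8 c_5^8$ with the second identity yields
  $(y_1^4 y_5^4 + 8 q)^2 = (x_1^4 x_5^4 - 16 q^3 c_1^4 c_5^4)^2$, and the constant terms
  decide the sign of the square root. The triple product formula turns both identities into
  identities between theta series, where they are linear substitutions on the lattice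
  $\mathbb{Z}^2$: Jacobi's comes from the index 2 map $(k, l) \mapsto (k + l, k - l)$, the other
  one from multiplication by the element $1 + \sqrt{-5}$ of norm 6.
\<close>

unbundle fps_syntax

section \<open>Limits of formal power series\<close>

lemma fps_mult_nth_cong:
  assumes "\<And>k. k \<le> n \<Longrightarrow> f $ k = f' $ k" "\<And>k. k \<le> n \<Longrightarrow> g $ k = g' $ k"
  shows "(f * g) $ n = (f' * g') $ n"
  by (simp add: fps_mult_nth assms)

text \<open>Convergence of power series means that every coefficient is eventually constant, and
  coefficient n of a product depends only on coefficients 0 to n of the factors.\<close>

lemma tendsto_mult_fps:
  fixes f g :: "'b \<Rightarrow> 'a :: ring fps"
  assumes "(f \<longlongrightarrow> a) F" "(g \<longlongrightarrow> b) F"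
  shows "((\<lambda>x. f x * g x) \<longlongrightarrow> a * b) F"
proof (rule tendsto_fpsI)
  fix n
  have "eventually (\<lambda>x. \<forall>k\<in>{..n}. f x $ k = a $ k) F" "eventually (\<lambda>x. \<forall>k\<in>{..n}. g x $ k = b $ k) F"
    by (subst eventually_ball_finite_distrib; use assms in \<open>auto simp: tendsto_fps_iff\<close>)+
  then show "eventually (\<lambda>x. (f x * g x) $ n = (a * b) $ n) F"
    by eventually_elim (rule fps_mult_nth_cong; simp)
qed

text \<open>Meaningful only if \<^term>\<open>a i - 1\<close> is divisible by \<^term>\<open>fps_X ^ Suc i\<close>.\<close>
definition infprod_fps :: "(nat \<Rightarrow> real fps) \<Rightarrow> real fps" where
  "infprod_fps a = Abs_fps (\<lambda>n. (\<Prod>i\<le>n. a i) $ n)"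

lemma fps_dvd_nth_eq:
  fixes f g :: "'a :: comm_ring_1 fps"
  assumes "fps_X ^ m dvd f - g" "n < m"
  shows "f $ n = g $ n"
proof -
  from assms(1) obtain h where "f - g = fps_X ^ m * h" by (elim dvdE)
  then have "(f - g) $ n = 0" using assms(2) by (simp add: fps_X_power_mult_nth)
  then show ?thesis by simp
qed

text \<open>Each factor from index m on is 1 modulo d, so it changes the product only by a multiple
  of d.\<close>

lemma prod_dvd_diff:
  fixes a :: "nat \<Rightarrow> 'a :: comm_ring_1"
  assumes "\<And>i. i \<ge> m \<Longrightarrow> d dvd a i - 1" "m \<le> n"
  shows "d dvd (\<Prod>i<n. a i) - (\<Prod>i<m. a i)"
  using assms(2)
proof (induction n rule: dec_induct)
  case (step n)
  have "(\<Prod>i<Suc n. a i) - (\<Prod>i<m. a i) = (\<Prod>i<n. a i) * (a n - 1) + ((\<Prod>i<n. a i) - (\<Prod>i<m. a i))"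
    by (simp add: algebra_simps)
  then show ?case using step assms(1) by (metis dvd_add dvd_mult)
qed auto

text \<open>Factors of index above n are 1 modulo X^(n+1), so coefficient n is stable once factor n
  is included.\<close>

lemma infprod_fps_nth:
  assumes "\<And>i. fps_X ^ Suc i dvd a i - 1" "n < m"
  shows "infprod_fps a $ n = (\<Prod>i<m. a i) $ n"
proof -
  have "fps_X ^ Suc n dvd (\<Prod>i<m. a i) - (\<Prod>i<Suc n. a i)"
  proof (rule prod_dvd_diff)
    show "fps_X ^ Suc n dvd a i - 1" if "Suc n \<le> i" for i
      using that by (intro dvd_trans[OF le_imp_power_dvd assms(1)[of i]]) auto
  qed (use assms(2) in auto)
  then have "(\<Prod>i<m. a i) $ n = (\<Prod>i<Suc n. a i) $ n"
    by (rule fps_dvd_nth_eq) auto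
  then show ?thesis by (simp add: infprod_fps_def lessThan_Suc_atMost)
qed

lemma tendsto_infprod_fps:
  assumes "\<And>i. fps_X ^ Suc i dvd a i - 1"
  shows "(\<lambda>m. \<Prod>i<m. a i) \<longlonglongrightarrow> infprod_fps a"
proof (rule tendsto_fpsI)
  fix n
  show "eventually (\<lambda>m. (\<Prod>i<m. a i) $ n = infprod_fps a $ n) sequentially"
    using eventually_gt_at_top[of n] by eventually_elim (simp add: infprod_fps_nth[OF assms])
qed

section \<open>The triple product formula\<close>

definition qpoch :: "real fps \<Rightarrow> nat \<Rightarrow> real fps" where
  "qpoch Q n = (\<Prod>i<n. 1 - Q ^ Suc i)"

text \<open>The Gaussian binomial coefficient of $m + n$ over $n$.\<close>
definition qbin :: "real fps \<Rightarrow> nat \<Rightarrow> nat \<Rightarrow> real fps" where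
  "qbin Q m n = qpoch Q (m + n) * inverse (qpoch Q m) * inverse (qpoch Q n)"

lemma qpoch_0 [simp]: "qpoch Q 0 = 1"
  by (simp add: qpoch_def)

lemma qpoch_Suc: "qpoch Q (Suc n) = qpoch Q n * (1 - Q ^ Suc n)"
  by (simp add: qpoch_def)

lemma fps_prod_nth_0: "(\<Prod>i\<in>A. f i) $ 0 = (\<Prod>i\<in>A. f i $ 0)" for f :: "_ \<Rightarrow> 'a :: comm_ring_1 fps"
  by (induction A rule: infinite_finite_induct) auto

lemma qpoch_inverse:
  assumes "Q $ 0 = 0"
  shows "qpoch Q n * inverse (qpoch Q n) = 1"
  using assms by (intro inverse_mult_eq_1') (simp add: qpoch_def fps_prod_nth_0)

lemma qpoch_inverse_Suc:
  assumes "Q $ 0 = 0"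
  shows "inverse (qpoch Q (Suc n)) * (1 - Q ^ Suc n) = inverse (qpoch Q n)"
proof -
  have "inverse (qpoch Q n) * (qpoch Q (Suc n) * inverse (qpoch Q (Suc n)))
     = (qpoch Q n * inverse (qpoch Q n)) * ((1 - Q ^ Suc n) * inverse (qpoch Q (Suc n)))"
    by (simp only: qpoch_Suc mult_ac)
  then show ?thesis by (simp add: qpoch_inverse[OF assms] mult_ac)
qed

lemma qbin_commute: "qbin Q m n = qbin Q n m"
  by (simp add: qbin_def mult_ac add_ac)

lemma qbin_0 [simp]: "Q $ 0 = 0 \<Longrightarrow> qbin Q m 0 = 1" "Q $ 0 = 0 \<Longrightarrow> qbin Q 0 m = 1"
  by (simp_all add: qbin_def qpoch_inverse)

text \<open>A q-Pascal rule. The top factor of the numerator splits as (1 - Q^(m+1)) + Q^(m+1) (1 -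
  Q^(n+1)), and each summand cancels the top factor of one denominator.\<close>

lemma qbin_Suc_Suc:
  assumes "Q $ 0 = 0"
  shows "qbin Q (Suc m) (Suc n) = qbin Q m (Suc n) + Q ^ Suc m * qbin Q (Suc m) n"
proof -
  define I where "I j = inverse (qpoch Q j)" for j
  have *: "1 - Q ^ Suc (Suc (m + n)) = (1 - Q ^ Suc m) + Q ^ Suc m * (1 - Q ^ Suc n)"
    by (simp add: algebra_simps flip: power_add)
  have "qbin Q (Suc m) (Suc n) = qpoch Q (Suc (m + n)) *
     (I (Suc m) * (1 - Q ^ Suc m) * I (Suc n) + Q ^ Suc m * I (Suc m) * (I (Suc n) * (1 - Q ^ Suc n)))"
    unfolding qbin_def I_def[symmetric] by (simp add: qpoch_Suc[of _ "Suc (m+n)"] * algebra_simps del: power_Suc)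
  also have "\<dots> = qbin Q m (Suc n) + Q ^ Suc m * qbin Q (Suc m) n"
    unfolding qbin_def I_def qpoch_inverse_Suc[OF assms] by (simp add: algebra_simps)
  finally show ?thesis .
qed

text \<open>Modulo Q^(mu+1) all four Pochhammer symbols involved agree with
  \<open>qpoch Q \<mu>\<close>, so numerator and denominator cancel. This drives the passage from
  the finite to the infinite triple product.\<close>

lemma qbin_approx:
  assumes Q: "Q $ 0 = 0" and "\<mu> \<le> m" "\<mu> \<le> n" "\<mu> \<le> l"
  shows "Q ^ Suc \<mu> dvd qbin Q m n * qpoch Q l - 1"
proof -
  define p where "p = qpoch Q \<mu>"
  have d: "Q ^ Suc \<mu> dvd qpoch Q j - p" if "\<mu> \<le> j" for j
    unfolding p_def qpoch_def
  proof (rule prod_dvd_diff[OF _ that])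
    fix i assume "\<mu> \<le> i"
    then have "Q ^ Suc \<mu> dvd Q ^ Suc i" by (intro le_imp_power_dvd) auto
    then show "Q ^ Suc \<mu> dvd 1 - Q ^ Suc i - 1" by simp
  qed
  let ?a = "qpoch Q (m + n)" and ?b = "qpoch Q l" and ?c = "qpoch Q m" and ?d = "qpoch Q n"
  have "?a * ?b - ?c * ?d = (?a - p) * ?b + p * (?b - p) - (?c - p) * ?d - p * (?d - p)"
    by (simp add: algebra_simps)
  also have "Q ^ Suc \<mu> dvd \<dots>"
    by (intro dvd_diff dvd_add dvd_mult dvd_mult2 d) (use assms in auto)
  finally have "Q ^ Suc \<mu> dvd (?a * ?b - ?c * ?d) * (inverse ?c * inverse ?d)" by (rule dvd_mult2)
  also have "(?a * ?b - ?c * ?d) * (inverse ?c * inverse ?d) =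
     qbin Q m n * qpoch Q l - (?c * inverse ?c) * (?d * inverse ?d)"
    by (simp add: qbin_def algebra_simps)
  finally show ?thesis by (simp add: qpoch_inverse Q)
qed

section \<open>The finite triple product\<close>

definition tri :: "int \<Rightarrow> nat" where
  "tri k = nat (k * (k + 1) div 2)"

text \<open>A product of two consecutive integers is even and never negative, so neither
  \<open>div\<close> nor \<open>nat\<close> loses anything, also for negative k.\<close>

lemma int_tri: "2 * int (tri k) = k * (k + 1)"
proof -
  have "k * (k + 1) \<ge> 0" by (cases "k \<ge> 0") (auto intro: mult_nonpos_nonpos)
  then show ?thesis by (simp add: tri_def)
qed

lemma double_int_eqD: "2 * int m = 2 * int n \<Longrightarrow> m = n"
  by simp

text \<open>The $k$-th term of Ramanujan's theta function $f(a,b)$; both exponents are natural numbers for every integer $k$, so no inverse of $a$ or $b$ is needed.\<close>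
definition ramanujan_term :: "real fps \<Rightarrow> real fps \<Rightarrow> int \<Rightarrow> real fps" where
  "ramanujan_term a b k = a ^ tri k * b ^ tri (- k)"

text \<open>The quotient of consecutive terms is a (ab)^k. The extra powers of ab keep all exponents
  natural when k is negative.\<close>

lemma ramanujan_term_shift:
  assumes "k \<le> int m"
  shows "ramanujan_term a b k * (a * (a * b) ^ m) = ramanujan_term a b (k + 1) * (a * b) ^ nat (int m - k)"
proof -
  define j where "j = nat (int m - k)"
  have j: "int j = int m - k" using assms by (simp add: j_def)
  have "2 * int (tri k + 1 + m) = 2 * int (tri (k + 1) + j)"
    using int_tri[of k] int_tri[of "k + 1"] j by (simp add: algebra_simps)
  then have 1: "tri k + 1 + m = tri (k + 1) + j" by (rule double_int_eqD)
  have "2 * int (tri (- k) + m) = 2 * int (tri (- (k + 1)) + j)"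
    using int_tri[of "- k"] int_tri[of "- (k + 1)"] j by (simp add: algebra_simps)
  then have 2: "tri (- k) + m = tri (- (k + 1)) + j" by (rule double_int_eqD)
  have "ramanujan_term a b k * (a * (a * b) ^ m) = a ^ (tri k + 1 + m) * b ^ (tri (- k) + m)"
    by (simp add: ramanujan_term_def power_add power_mult_distrib mult_ac)
  also have "\<dots> = ramanujan_term a b (k + 1) * (a * b) ^ j"
    unfolding 1 2 by (simp add: ramanujan_term_def power_add power_mult_distrib mult_ac)
  finally show ?thesis by (simp add: j_def)
qed

lemma ramanujan_term_commute: "ramanujan_term a b k = ramanujan_term b a (- k)"
  by (simp add: ramanujan_term_def mult.commute)

lemma sum_int_shift: "(\<Sum>k=x..y. f (k + 1)) = (\<Sum>k=x+1..y+1. f k)" for x y :: int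
  by (rule sum.reindex_bij_witness[of _ "\<lambda>k. k - 1" "\<lambda>k. k + 1"]) auto

text \<open>Multiplication by a (ab)^m shifts the summation index by one; adding the shifted sum to
  the original one is then the q-Pascal rule, term by term.\<close>

lemma finite_triple_product_step:
  assumes Q: "(a * b) $ 0 = 0"
  defines "S \<equiv> \<lambda>m n. \<Sum>k=-int n..int m. ramanujan_term a b k * qbin (a * b) (nat (int m - k)) (nat (int n + k))"
  shows "S m n * (1 + a * (a * b) ^ m) = S (Suc m) n"
proof -
  let ?Q = "a * b" and ?T = "ramanujan_term a b"
  define h where "h k = ?T k * (?Q ^ nat (int m + 1 - k) * qbin ?Q (nat (int m + 1 - k)) (nat (int n + k - 1)))" for k
  define g where "g k = ?T k * qbin ?Q (nat (int m - k)) (nat (int n + k))" for k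
  have "S m n * (a * ?Q ^ m) = (\<Sum>k=-int n..int m. h (k + 1))"
    unfolding S_def sum_distrib_right
  proof (rule sum.cong)
    fix k assume "k \<in> {-int n..int m}"
    then show "?T k * qbin ?Q (nat (int m - k)) (nat (int n + k)) * (a * ?Q ^ m) = h (k + 1)"
      using ramanujan_term_shift[of k m a b] by (simp add: h_def mult_ac)
  qed auto
  also have "\<dots> = (\<Sum>k=-int n+1..int m+1. h k)" by (rule sum_int_shift)
  finally have 1: "S m n * (a * ?Q ^ m) = (\<Sum>k=-int n+1..int m+1. h k)" .
  \<comment> \<open>The two extreme terms are split off because the q-Pascal rule needs both
    arguments positive; there the binomial coefficients are 1.\<close>
  have ends: "{-int n..int m} = insert (-int n) {-int n+1..int m}" "{-int n+1..int m+1} = insert (int m + 1) {-int n+1..int m}"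
    "{-int n..int (Suc m)} = insert (-int n) (insert (int m + 1) {-int n+1..int m})"
    by auto
  have "S (Suc m) n = ?T (- int n) + ?T (int m + 1) +
    (\<Sum>k=-int n+1..int m. ?T k * qbin ?Q (nat (int (Suc m) - k)) (nat (int n + k)))"
    unfolding S_def ends using Q by (simp add: add_ac)
  also have "(\<Sum>k=-int n+1..int m. ?T k * qbin ?Q (nat (int (Suc m) - k)) (nat (int n + k))) =
    (\<Sum>k=-int n+1..int m. g k + h k)"
  proof (rule sum.cong)
    fix k assume k: "k \<in> {-int n+1..int m}"
    define u where "u = nat (int m - k)"
    define v where "v = nat (int n + k - 1)"
    have "nat (int (Suc m) - k) = Suc u" "nat (int m + 1 - k) = Suc u" "nat (int m - k) = u" "nat (int n + k) = Suc v" "nat (int n + k - 1) = v"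
      using k by (auto simp: u_def v_def)
    then show "?T k * qbin ?Q (nat (int (Suc m) - k)) (nat (int n + k)) = g k + h k"
      unfolding g_def h_def using qbin_Suc_Suc[OF Q, of u v] by (simp add: algebra_simps)
  qed auto
  also have "?T (- int n) + ?T (int m + 1) + \<dots> = (\<Sum>k=-int n..int m. g k) + (\<Sum>k=-int n+1..int m+1. h k)"
    unfolding ends using Q by (simp add: sum.distrib g_def h_def)
  also have "\<dots> = S m n + S m n * (a * ?Q ^ m)"
    unfolding 1 by (simp add: S_def g_def)
  finally show ?thesis by (simp add: algebra_simps)
qed

text \<open>Induction on m. The base case m = 0 is an induction on n by the same step, with a and b
  exchanged through k -> -k.\<close>

lemma finite_triple_product:
  assumes Q: "(a * b) $ 0 = 0"
  shows "(\<Prod>i<m. 1 + a * (a * b) ^ i) * (\<Prod>i<n. 1 + b * (a * b) ^ i) =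
    (\<Sum>k=-int n..int m. ramanujan_term a b k * qbin (a * b) (nat (int m - k)) (nat (int n + k)))"
proof (induction m)
  case (Suc m)
  then show ?case using finite_triple_product_step[OF Q, of m n] by (simp add: mult_ac)
next
  case 0
  show ?case
  proof (induction n)
    case 0
    show ?case using Q by (simp add: ramanujan_term_def tri_def)
  next
    case (Suc n)
    have *: "(\<Sum>k=-int n..int 0. ramanujan_term a b k * qbin (a * b) (nat (int 0 - k)) (nat (int n + k))) =
      (\<Sum>k=-int 0..int n. ramanujan_term b a k * qbin (b * a) (nat (int n - k)) (nat (int 0 + k)))" for n
    proof (rule sum.reindex_bij_witness[of _ uminus uminus])
      fix k assume "k \<in> {- int n..int 0}"
      then show "ramanujan_term b a (- k) * qbin (b * a) (nat (int n - - k)) (nat (int 0 + - k)) =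
        ramanujan_term a b k * qbin (a * b) (nat (int 0 - k)) (nat (int n + k))"
        by (simp add: ramanujan_term_commute[of b a] qbin_commute[of _ "nat (int n + k)"] mult.commute[of b a])
    qed auto
    have Q': "(b * a) $ 0 = 0" using Q by (simp add: mult.commute)
    show ?case using Suc finite_triple_product_step[OF Q', of n 0] unfolding * by (simp add: mult_ac)
  qed
qed

section \<open>Passage to the infinite triple product\<close>

definition genfun :: "'a set \<Rightarrow> ('a \<Rightarrow> int) \<Rightarrow> ('a \<Rightarrow> real) \<Rightarrow> real fps" where
  "genfun A w s = Abs_fps (\<lambda>n. \<Sum>i | i \<in> A \<and> w i = int n. s i)"

lemma genfun_nth: "genfun A w s $ n = (\<Sum>i | i \<in> A \<and> w i = int n. s i)"
  by (simp add: genfun_def)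

text \<open>Ensures that indices k with |k| > m contribute only exponents at least m.\<close>

lemma tri_growth:
  assumes "\<alpha> + \<beta> > 0"
  shows "nat \<bar>k\<bar> \<le> Suc (\<alpha> * tri k + \<beta> * tri (- k))"
proof -
  have *: "nat \<bar>k\<bar> \<le> Suc (tri k)" for k
  proof -
    \<comment> \<open>No integer lies strictly between 1 and 2.\<close>
    have "0 \<le> (\<bar>k\<bar> - 1) * (\<bar>k\<bar> - 2)"
      by (cases "\<bar>k\<bar> \<le> 1") (auto intro: mult_nonpos_nonpos)
    then have "2 * \<bar>k\<bar> \<le> 2 + k * (k + 1)"
      by (auto simp: algebra_simps abs_if split: if_splits)
    then show ?thesis using int_tri[of k] by linarith
  qed
  consider "\<alpha> \<ge> 1" | "\<beta> \<ge> 1" using assms by linarith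
  then show ?thesis
  proof cases
    case 1
    then have "tri k \<le> \<alpha> * tri k" by simp
    then show ?thesis using *[of k] by linarith
  next
    case 2
    then have "tri (-k) \<le> \<beta> * tri (-k)" by simp
    moreover have "nat \<bar>k\<bar> \<le> Suc (tri (- k))" using *[of "- k"] by simp
    ultimately show ?thesis by linarith
  qed
qed

text \<open>The finite formula with m = n, multiplied by \<open>qpoch (a * b) m\<close>, has each
  binomial coefficient replaced by something close to 1. The constant c carries the signs of the
  theta series.\<close>

theorem triple_product:
  fixes c :: real
  assumes pos: "\<alpha> + \<beta> > 0"
  defines "a \<equiv> fps_const c * fps_X ^ \<alpha>" and "b \<equiv> fps_const c * fps_X ^ \<beta>"
  shows "(\<lambda>m. \<Prod>i<m. (1 + a * (a * b) ^ i) * (1 + b * (a * b) ^ i) * (1 - (a * b) ^ Suc i))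
    \<longlonglongrightarrow> genfun UNIV (\<lambda>k. int (\<alpha> * tri k + \<beta> * tri (- k))) (\<lambda>k. c ^ (tri k + tri (- k)))"
proof (rule tendsto_fpsI)
  fix n
  define w where "w k = \<alpha> * tri k + \<beta> * tri (- k)" for k
  have Q: "a * b = fps_const (c\<^sup>2) * fps_X ^ (\<alpha> + \<beta>)"
    by (simp add: a_def b_def power_add power2_eq_square mult_ac flip: fps_const_mult)
  have Q0: "(a * b) $ 0 = 0" and XQ: "fps_X dvd a * b"
    using pos unfolding Q by (auto intro!: dvd_mult dvd_power)
  have T: "ramanujan_term a b k = fps_const (c ^ (tri k + tri (- k))) * fps_X ^ w k" for k
    by (simp add: ramanujan_term_def a_def b_def w_def power_mult_distrib power_add power_mult
       mult_ac flip: fps_const_mult)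
  show "eventually (\<lambda>m. (\<Prod>i<m. (1 + a * (a * b) ^ i) * (1 + b * (a * b) ^ i) * (1 - (a * b) ^ Suc i)) $ n =
       genfun UNIV (\<lambda>k. int (\<alpha> * tri k + \<beta> * tri (- k))) (\<lambda>k. c ^ (tri k + tri (- k))) $ n) sequentially"
    using eventually_gt_at_top[of n]
  proof eventually_elim
    case (elim m)
    let ?G = "\<lambda>k. qbin (a * b) (nat (int m - k)) (nat (int m + k)) * qpoch (a * b) m"
    have "(\<Prod>i<m. (1 + a * (a * b) ^ i) * (1 + b * (a * b) ^ i) * (1 - (a * b) ^ Suc i)) =
      (\<Sum>k=-int m..int m. ramanujan_term a b k * ?G k)"
      unfolding prod.distrib finite_triple_product[OF Q0]
      by (simp only: qpoch_def sum_distrib_right mult.assoc)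
    moreover have "(ramanujan_term a b k * ?G k) $ n = ramanujan_term a b k $ n"
      if k: "k \<in> {-int m..int m}" for k
    proof (rule fps_dvd_nth_eq[OF _ elim])
      define \<mu> where "\<mu> = m - nat \<bar>k\<bar>"
      have "(a * b) ^ Suc \<mu> dvd ?G k - 1"
        using k by (intro qbin_approx Q0) (auto simp: \<mu>_def)
      with XQ have "fps_X ^ Suc \<mu> dvd ?G k - 1"
        by (meson dvd_power_same dvd_trans)
      then have "fps_X ^ w k * fps_X ^ Suc \<mu> dvd ramanujan_term a b k * (?G k - 1)"
        unfolding T by (intro mult_dvd_mono dvd_mult) auto
      \<comment> \<open>The precision lost for k near the ends is regained from the exponent
        \<open>w k\<close>, which is at least |k| - 1.\<close>
      moreover have "m \<le> w k + Suc \<mu>"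
        using tri_growth[OF pos, of k] by (simp add: w_def \<mu>_def)
      ultimately have "fps_X ^ m dvd ramanujan_term a b k * (?G k - 1)"
        unfolding power_add[symmetric] by (rule dvd_trans[OF le_imp_power_dvd, rotated])
      then show "fps_X ^ m dvd ramanujan_term a b k * ?G k - ramanujan_term a b k"
        by (simp add: algebra_simps)
    qed
    ultimately have "(\<Prod>i<m. (1 + a * (a * b) ^ i) * (1 + b * (a * b) ^ i) * (1 - (a * b) ^ Suc i)) $ n
      = (\<Sum>k=-int m..int m. ramanujan_term a b k $ n)"
      by (simp add: fps_sum_nth)
    also have "\<dots> = (\<Sum>k=-int m..int m. if w k = n then c ^ (tri k + tri (- k)) else 0)"
      by (rule sum.cong) (auto simp: T)
    also have "\<dots> = (\<Sum>k | k \<in> {-int m..int m} \<and> w k = n. c ^ (tri k + tri (- k)))"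
      by (rule sum.inter_filter[symmetric]) simp
    also have "{k. k \<in> {-int m..int m} \<and> w k = n} = {k. k \<in> UNIV \<and> int (w k) = int n}"
    proof -
      have "k \<in> {-int m..int m}" if "w k = n" for k
        using tri_growth[OF pos, of k] that elim by (auto simp: w_def)
      then show ?thesis by auto
    qed
    finally show ?case unfolding genfun_nth w_def .
  qed
qed

section \<open>Theta series as lattice sums\<close>

text \<open>Finite level sets keep the coefficient sums of \<open>genfun\<close> from defaulting to
  0; nonnegative weights make every element count in the series.\<close>

definition admissible :: "'a set \<Rightarrow> ('a \<Rightarrow> int) \<Rightarrow> bool" where
  "admissible A w \<longleftrightarrow> (\<forall>i\<in>A. w i \<ge> 0) \<and> (\<forall>n. finite {i \<in> A. w i = n})"

lemma admissible_Times:
  assumes "admissible A w" "admissible B v"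
  shows "admissible (A \<times> B) (\<lambda>(i, j). w i + v j)"
  unfolding admissible_def
proof (intro conjI allI)
  fix n
  have "{p \<in> A \<times> B. (case p of (i, j) \<Rightarrow> w i + v j) = n} \<subseteq>
    (\<Union>m\<in>{0..n}. {i \<in> A. w i = m} \<times> {j \<in> B. v j = n - m})"
    using assms by (auto simp: admissible_def)
  then show "finite {p \<in> A \<times> B. (case p of (i, j) \<Rightarrow> w i + v j) = n}"
    by (rule finite_subset) (use assms in \<open>auto simp: admissible_def\<close>)
qed (use assms in \<open>auto simp: admissible_def\<close>)

text \<open>The Cauchy product: the pairs of total weight n are grouped by the weight m of the first
  component.\<close>

lemma genfun_mult:
  assumes "admissible A w" "admissible B v"
  shows "genfun A w s * genfun B v t = genfun (A \<times> B) (\<lambda>(i, j). w i + v j) (\<lambda>(i, j). s i * t j)"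
proof (rule fps_ext)
  fix n
  let ?U = "\<Union>m\<le>n. {i \<in> A. w i = int m} \<times> {j \<in> B. v j = int (n - m)}"
  have "(genfun A w s * genfun B v t) $ n =
    (\<Sum>m\<le>n. \<Sum>(i, j)\<in>{i \<in> A. w i = int m} \<times> {j \<in> B. v j = int (n - m)}. s i * t j)"
    by (simp add: fps_mult_nth genfun_nth sum_product sum.cartesian_product atLeast0AtMost)
  also have "\<dots> = (\<Sum>(i, j)\<in>?U. s i * t j)"
    by (rule sum.UNION_disjoint[symmetric]) (use assms in \<open>auto simp: admissible_def\<close>)
  also have "?U = {p. p \<in> A \<times> B \<and> (case p of (i, j) \<Rightarrow> w i + v j) = int n}"
  proof (intro equalityI subsetI)
    fix p assume "p \<in> {p. p \<in> A \<times> B \<and> (case p of (i, j) \<Rightarrow> w i + v j) = int n}"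
    then obtain i j where p: "p = (i, j)" "i \<in> A" "j \<in> B" "w i + v j = int n" by auto
    then have "w i \<ge> 0" "v j \<ge> 0" using assms by (auto simp: admissible_def)
    with p show "p \<in> ?U"
      by (auto intro!: bexI[of _ "nat (w i)"])
  qed auto
  finally show "(genfun A w s * genfun B v t) $ n =
      genfun (A \<times> B) (\<lambda>(i, j). w i + v j) (\<lambda>(i, j). s i * t j) $ n"
    by (simp add: genfun_nth)
qed

lemma genfun_split:
  assumes "admissible A w"
  shows "genfun A w s = genfun {i \<in> A. P i} w s + genfun {i \<in> A. \<not> P i} w s"
proof (rule fps_ext)
  fix n
  have "{i. i \<in> A \<and> w i = int n} = {i \<in> {i \<in> A. P i}. w i = int n} \<union> {i \<in> {i \<in> A. \<not> P i}. w i = int n}"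
    by auto
  moreover have "finite {i \<in> {i \<in> A. Q i}. w i = int n}" for Q
    using assms by (auto simp: admissible_def intro: rev_finite_subset)
  ultimately show "genfun A w s $ n = (genfun {i \<in> A. P i} w s + genfun {i \<in> A. \<not> P i} w s) $ n"
    by (simp only: genfun_nth fps_add_nth) (subst sum.union_disjoint, auto)
qed

text \<open>Every substitution on the lattice below goes through this rule, with an explicit inverse
  g.\<close>

lemma genfun_reindex:
  assumes "\<And>x. x \<in> A \<Longrightarrow> f x \<in> B" "\<And>x. x \<in> A \<Longrightarrow> g (f x) = x"
    "\<And>y. y \<in> B \<Longrightarrow> g y \<in> A" "\<And>y. y \<in> B \<Longrightarrow> f (g y) = y"
    "\<And>x. x \<in> A \<Longrightarrow> v (f x) = w x" "\<And>x. x \<in> A \<Longrightarrow> t (f x) = s x"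
  shows "genfun A w s = genfun B v t"
proof (rule fps_ext)
  fix n
  have "w (g y) = v y" if "y \<in> B" for y using assms that by metis
  then show "genfun A w s $ n = genfun B v t $ n"
    unfolding genfun_nth
    by (intro sum.reindex_bij_witness[of _ g f]) (use assms in auto)
qed

lemma genfun_cong:
  assumes "\<And>x. x \<in> A \<Longrightarrow> w x = v x" "\<And>x. x \<in> A \<Longrightarrow> s x = t x"
  shows "genfun A w s = genfun A v t"
  by (rule genfun_reindex[of _ id _ id]) (use assms in auto)

lemma genfun_shift:
  assumes "admissible A w"
  shows "fps_X ^ d * genfun A w s = genfun A (\<lambda>i. w i + int d) s"
proof (rule fps_ext)
  fix n
  show "(fps_X ^ d * genfun A w s) $ n = genfun A (\<lambda>i. w i + int d) s $ n"
  proof (cases "n < d")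
    case True
    then have "{i \<in> A. w i + int d = int n} = {}"
      using assms by (force simp: admissible_def)
    then show ?thesis using True by (simp only: fps_X_power_mult_nth genfun_nth if_True sum.empty)
  next
    case False
    then have "{i. i \<in> A \<and> w i = int (n - d)} = {i. i \<in> A \<and> w i + int d = int n}" by auto
    then show ?thesis using False by (simp only: fps_X_power_mult_nth genfun_nth if_False)
  qed
qed

lemma genfun_uminus: "genfun A w (\<lambda>i. - s i) = - genfun A w s"
  by (rule fps_ext) (auto simp: genfun_nth sum_negf)

section \<open>Theta series in one variable\<close>

abbreviation parity_sign :: "int \<Rightarrow> real" where
  "parity_sign k \<equiv> (if even k then 1 else - 1)"

text \<open>Jacobi's theta functions of the nome $q^d$; for \<open>theta2\<close> the factor $q^{d/4}$ is dropped.\<close>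
definition theta3 :: "nat \<Rightarrow> real fps" where
  "theta3 d = genfun UNIV (\<lambda>k. int d * k\<^sup>2) (\<lambda>_. 1)"

definition theta4 :: "nat \<Rightarrow> real fps" where
  "theta4 d = genfun UNIV (\<lambda>k. int d * k\<^sup>2) parity_sign"

definition theta2 :: "nat \<Rightarrow> real fps" where
  "theta2 d = genfun UNIV (\<lambda>k. int d * (k\<^sup>2 + k)) (\<lambda>_. 1)"

text \<open>The exponents are d times the generalized pentagonal numbers k(3k+1)/2 of Euler's
  theorem.\<close>

definition pentagonal :: "nat \<Rightarrow> real fps" where
  "pentagonal d = genfun UNIV (\<lambda>k. int d * (k\<^sup>2 + int (tri k))) parity_sign"

text \<open>At least linear growth bounds the level sets. The slack of 1 is needed for k^2 + k,
  which vanishes at k = -1.\<close>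

lemma admissible_intI:
  assumes "d > 0" "\<And>k::int. 0 \<le> w k" "\<And>k::int. \<bar>k\<bar> \<le> w k + 1"
  shows "admissible UNIV (\<lambda>k. int d * w k)"
  unfolding admissible_def
proof (intro conjI allI ballI)
  show "0 \<le> int d * w k" for k using assms(2) by simp
  fix n
  have "k \<in> {- n - 1..n + 1}" if "int d * w k = n" for k
  proof -
    have "1 * w k \<le> int d * w k" using assms(1,2) by (intro mult_right_mono) auto
    then show ?thesis using that assms(3)[of k] by auto
  qed
  then have "{k \<in> UNIV. int d * w k = n} \<subseteq> {- n - 1..n + 1}"
    by blast
  then show "finite {k \<in> UNIV. int d * w k = n}"
    by (rule finite_subset) auto
qed

lemma admissible_theta:
  assumes "d > 0"
  shows "admissible UNIV (\<lambda>k. int d * k\<^sup>2)"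
    and "admissible UNIV (\<lambda>k. int d * (k\<^sup>2 + k))"
    and "admissible UNIV (\<lambda>k. int d * (k\<^sup>2 + int (tri k)))"
proof -
  have 1: "\<bar>k\<bar> \<le> k\<^sup>2" for k :: int
    using mult_right_mono[of 1 "\<bar>k\<bar>" "\<bar>k\<bar>"] by (cases "k = 0") (auto simp: power2_eq_square)
  have 2: "\<bar>k\<bar> \<le> k\<^sup>2 + k + 1" for k :: int
  proof (cases "k \<ge> 0")
    case False
    have "0 \<le> (k + 1)\<^sup>2" by simp
    then show ?thesis using False by (simp add: power2_eq_square algebra_simps)
  qed (use 1[of k] in auto)
  have 3: "0 \<le> k\<^sup>2 + k" for k :: int using 1[of k] by linarith
  have 4: "\<bar>k\<bar> \<le> k\<^sup>2 + 1" "\<bar>k\<bar> \<le> k\<^sup>2 + int (tri k) + 1" for k using 1[of k] by linarith+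
  show "admissible UNIV (\<lambda>k. int d * k\<^sup>2)" "admissible UNIV (\<lambda>k. int d * (k\<^sup>2 + k))"
    "admissible UNIV (\<lambda>k. int d * (k\<^sup>2 + int (tri k)))"
    by (rule admissible_intI[OF assms]; (rule 2 3 4 | simp))+
qed

section \<open>Parity classes of the lattice and Jacobi's identity\<close>

lemma genfun_even_pairs:
  "genfun {p \<in> UNIV :: (int \<times> int) set. even (fst p + snd p)} w s = genfun UNIV (\<lambda>(k, l). w (k + l, k - l)) (\<lambda>(k, l). s (k + l, k - l))"
  by (rule sym, rule genfun_reindex[of _ "\<lambda>(k, l). (k + l, k - l)" _ "\<lambda>(a, b). ((a + b) div 2, (a - b) div 2)"])
     (auto simp: algebra_simps elim!: evenE oddE)

lemma genfun_odd_pairs: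
  "genfun {p \<in> UNIV :: (int \<times> int) set. odd (fst p + snd p)} w s = genfun UNIV (\<lambda>(k, l). w (k + l + 1, k - l)) (\<lambda>(k, l). s (k + l + 1, k - l))"
  by (rule sym, rule genfun_reindex[of _ "\<lambda>(k, l). (k + l + 1, k - l)" _ "\<lambda>(a, b). ((a + b - 1) div 2, (a - b - 1) div 2)"])
     (auto simp: algebra_simps elim!: evenE oddE, presburger)

text \<open>The pairs with even sum form a sublattice of index 2, the image of (k, l) -> (k + l, k -
  l); the second summand is its other coset.\<close>

lemma genfun_parity_split:
  fixes w :: "int \<times> int \<Rightarrow> int"
  assumes "admissible UNIV w"
  shows "genfun UNIV w s = genfun UNIV (\<lambda>(k, l). w (k + l, k - l)) (\<lambda>(k, l). s (k + l, k - l)) +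
     genfun UNIV (\<lambda>(k, l). w (k + l + 1, k - l)) (\<lambda>(k, l). s (k + l + 1, k - l))"
  unfolding genfun_even_pairs[symmetric] genfun_odd_pairs[symmetric] by (rule genfun_split[OF assms])

lemma genfun_mult_UNIV:
  assumes "admissible UNIV w" "admissible UNIV v"
  shows "genfun UNIV w s * genfun UNIV v t = genfun UNIV (\<lambda>(i, j). w i + v j) (\<lambda>(i, j). s i * t j)"
    "admissible UNIV (\<lambda>(i, j). w i + v j)"
  using genfun_mult[OF assms] admissible_Times[OF assms] by simp_all

text \<open>On the two classes a^2 + b^2 becomes 2k^2 + 2l^2 and 2(k^2+k) + 2(l^2+l) + 1. The sign
  in the square of \<open>theta4\<close> is (-1)^(a+b), hence minus on the odd class. For
  \<open>theta2\<close> both classes give the same series.\<close>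

lemma theta_squares:
  assumes "d > 0"
  shows "theta3 d * theta3 d = theta3 (2 * d) * theta3 (2 * d) + fps_X ^ d * (theta2 (2 * d) * theta2 (2 * d))"
    and "theta4 d * theta4 d = theta3 (2 * d) * theta3 (2 * d) - fps_X ^ d * (theta2 (2 * d) * theta2 (2 * d))"
    and "theta2 d * theta2 d = 2 * (theta3 (2 * d) * theta2 (2 * d))"
proof -
  note adm = admissible_theta[OF assms]
  have "2 * d > 0" using assms by simp
  note adm2 = admissible_theta[OF this]
  note mult = genfun_mult_UNIV[OF adm(1) adm(1)] genfun_mult_UNIV[OF adm(2) adm(2)]
  note mult2 = genfun_mult_UNIV[OF adm2(1) adm2(1)] genfun_mult_UNIV[OF adm2(1) adm2(2)] genfun_mult_UNIV[OF adm2(2) adm2(2)]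
  have 1: "theta3 (2 * d) * theta3 (2 * d) = genfun UNIV (\<lambda>(k, l). int d * (k + l)\<^sup>2 + int d * (k - l)\<^sup>2) (\<lambda>_. 1)"
    unfolding theta3_def mult2 by (rule genfun_cong) (auto simp: power2_eq_square algebra_simps)
  have 2: "fps_X ^ d * (theta2 (2 * d) * theta2 (2 * d)) = genfun UNIV (\<lambda>(k, l). int d * (k + l + 1)\<^sup>2 + int d * (k - l)\<^sup>2) (\<lambda>_. 1)"
    unfolding theta2_def mult2(5) genfun_shift[OF mult2(6)] by (rule genfun_cong) (auto simp: power2_eq_square algebra_simps)
  have 3: "theta3 (2 * d) * theta2 (2 * d) = genfun UNIV (\<lambda>(l, k). int (2 * d) * l\<^sup>2 + int (2 * d) * (k\<^sup>2 + k)) (\<lambda>_. 1)"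
    unfolding theta3_def theta2_def mult2 by (rule genfun_cong) auto
  show "theta3 d * theta3 d = theta3 (2 * d) * theta3 (2 * d) + fps_X ^ d * (theta2 (2 * d) * theta2 (2 * d))"
    unfolding 1 2 unfolding theta3_def mult(1) genfun_parity_split[OF mult(2)]
    by (intro arg_cong2[of _ _ _ _ "(+)"] genfun_cong) auto
  show "theta4 d * theta4 d = theta3 (2 * d) * theta3 (2 * d) - fps_X ^ d * (theta2 (2 * d) * theta2 (2 * d))"
    unfolding 1 2 diff_conv_add_uminus genfun_uminus[symmetric]
    unfolding theta4_def mult(1) genfun_parity_split[OF mult(2)]
    by (intro arg_cong2[of _ _ _ _ "(+)"] genfun_cong) auto
  show "theta2 d * theta2 d = 2 * (theta3 (2 * d) * theta2 (2 * d))"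
    unfolding 3 mult_2[of "genfun UNIV _ _"]
    unfolding theta2_def mult(3) genfun_parity_split[OF mult(4)]
  proof (intro arg_cong2[of _ _ _ _ "(+)"], goal_cases)
    case 1
    show ?case by (rule genfun_reindex[of _ "\<lambda>(k, l). (l, k)" _ "\<lambda>(k, l). (l, k)"]) (auto simp: power2_eq_square algebra_simps)
  next
    \<comment> \<open>The odd class has weight 2(k+1)^2 + 2(l^2+l), up to the factor d.\<close>
    case 2
    show ?case by (rule genfun_reindex[of _ "\<lambda>(k, l). (k + 1, l)" _ "\<lambda>(k, l). (k - 1, l)"]) (auto simp: power2_eq_square algebra_simps)
  qed
qed

text \<open>The squares of \<open>theta3\<close> and \<open>theta4\<close> are a + qb and a - qb,
  and the difference of their squares is 4qab, where 4ab is the fourth power of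
  \<open>theta2\<close>.\<close>

lemma jacobi_quartic:
  assumes "d > 0"
  shows "theta3 d ^ 4 = theta4 d ^ 4 + fps_X ^ d * theta2 d ^ 4"
proof -
  define a b q where "a = theta3 (2 * d) * theta3 (2 * d)" and "b = theta2 (2 * d) * theta2 (2 * d)" and "q = (fps_X ^ d :: real fps)"
  have "theta3 d ^ 4 - theta4 d ^ 4 = (a + q * b)\<^sup>2 - (a - q * b)\<^sup>2"
    unfolding a_def b_def q_def theta_squares(1,2)[OF assms, symmetric]
    by (simp add: power2_eq_square power4_eq_xxxx mult_ac)
  also have "\<dots> = q * (4 * a * b)"
    by (simp add: algebra_simps power2_eq_square)
  also have "4 * a * b = theta2 d ^ 4"
  proof -
    have "theta2 d ^ 4 = (theta2 d * theta2 d) * (theta2 d * theta2 d)"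
      by (simp add: power4_eq_xxxx mult_ac)
    then show ?thesis unfolding theta_squares(3)[OF assms] by (simp add: a_def b_def mult_ac)
  qed
  finally show ?thesis by (simp add: q_def algebra_simps)
qed

section \<open>The theta identity relating the nomes q and q^5\<close>

lemma admissible_subset: "admissible A w \<Longrightarrow> B \<subseteq> A \<Longrightarrow> admissible B w"
  unfolding admissible_def by (auto intro: rev_finite_subset)

lemma genfun_residue_class:
  fixes r :: int
  assumes "0 \<le> r" "r < 3" "\<And>p. P p \<longleftrightarrow> (fst p + snd p) mod 3 = r"
  shows "genfun {p. P p} w s = genfun UNIV (\<lambda>(j, l). w (3 * j + r - l, l)) (\<lambda>(j, l). s (3 * j + r - l, l))"
  by (rule sym, rule genfun_reindex[of _ "\<lambda>(j, l). (3 * j + r - l, l)" _ "\<lambda>(k, l). ((k + l) div 3, l)"])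
     (use assms in \<open>auto simp: mult_div_mod_eq algebra_simps minus_mod_eq_mult_div[symmetric]\<close>)

text \<open>The three cosets of the sublattice where 3 divides k + l, each parametrized by l and the
  quotient j of k + l by 3.\<close>

lemma genfun_mod3_split:
  fixes w :: "int \<times> int \<Rightarrow> int"
  assumes "admissible UNIV w"
  shows "genfun UNIV w s = genfun UNIV (\<lambda>(j, l). w (3 * j - l, l)) (\<lambda>(j, l). s (3 * j - l, l)) +
     genfun UNIV (\<lambda>(j, l). w (3 * j + 1 - l, l)) (\<lambda>(j, l). s (3 * j + 1 - l, l)) +
     genfun UNIV (\<lambda>(j, l). w (3 * j + 2 - l, l)) (\<lambda>(j, l). s (3 * j + 2 - l, l))"
proof -
  let ?m = "\<lambda>p::int \<times> int. (fst p + snd p) mod 3"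
  have adm: "admissible {p \<in> UNIV. \<not> ?m p = 0} w"
    by (rule admissible_subset[OF assms]) auto
  have *: "?m p = 0 \<or> ?m p = 1 \<or> ?m p = 2" for p
    by presburger
  have "genfun UNIV w s = genfun {p. ?m p = 0} w s + (genfun {p. ?m p = 1} w s + genfun {p. ?m p = 2} w s)"
    unfolding genfun_split[OF assms, of s "\<lambda>p. ?m p = 0"] genfun_split[OF adm, of s "\<lambda>p. ?m p = 1"]
    by (intro arg_cong2[of _ _ _ _ "(+)"] arg_cong[of _ _ "\<lambda>A. genfun A w s"]) (use * in force)+
  then show ?thesis
    using genfun_residue_class[of 0 "\<lambda>p. ?m p = 0" w s] genfun_residue_class[of 1 "\<lambda>p. ?m p = 1" w s]
      genfun_residue_class[of 2 "\<lambda>p. ?m p = 2" w s] by simp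
qed

text \<open>The parity classes again, now with the second component kept as a coordinate, so that
  the weights of the pentagonal product match those of the residue classes modulo 3.\<close>

lemma genfun_parity_split':
  fixes w :: "int \<times> int \<Rightarrow> int"
  assumes "admissible UNIV w"
  shows "genfun UNIV w s = genfun UNIV (\<lambda>(j, l). w (j - 2 * l, j)) (\<lambda>(j, l). s (j - 2 * l, j)) +
     genfun UNIV (\<lambda>(j, l). w (j - 2 * l - 1, j)) (\<lambda>(j, l). s (j - 2 * l - 1, j))"
  unfolding genfun_parity_split[OF assms]
proof (intro arg_cong2[of _ _ _ _ "(+)"], goal_cases)
  case 1
  show ?case by (rule genfun_reindex[of _ "\<lambda>(k, l). (k - l, - l)" _ "\<lambda>(j, l). (j - l, - l)"]) (auto simp: algebra_simps)
next
  case 2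
  show ?case by (rule genfun_reindex[of _ "\<lambda>(k, l). (k - l, - l - 1)" _ "\<lambda>(j, l). (j - l - 1, - l - 1)"]) (auto simp: algebra_simps)
qed

text \<open>
  With $x = 2k+1$, $y = 2l$ in the first product and $x = 2k$, $y = 2l+1$ in the second, the left
  side sums $(-1)^y q^{(x^2+5y^2-1)/4}$ over $x + y$ odd. Put $X = x - 5y$, $Y = x + y$, so that
  $X^2 + 5Y^2 = 6(x^2+5y^2)$ and $X \equiv Y$ modulo 6. The terms with $X \equiv \pm 1$ give the
  right side, and those with $X \equiv 3$ cancel under $X \mapsto -X$. In the coordinates $k, l$
  the residue of $X$ is determined by $k + l$ modulo 3.
\<close>
lemma theta_quintic:
  "theta2 1 * theta3 5 - fps_X * (theta3 1 * theta2 5) = 2 * (pentagonal 1 * pentagonal 5)"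
proof -
  have adm: "admissible UNIV (\<lambda>k. k\<^sup>2)" "admissible UNIV (\<lambda>k. k\<^sup>2 + k)" "admissible UNIV (\<lambda>k. k\<^sup>2 + int (tri k))"
    "admissible UNIV (\<lambda>k. 5 * k\<^sup>2)" "admissible UNIV (\<lambda>k. 5 * (k\<^sup>2 + k))" "admissible UNIV (\<lambda>k. 5 * (k\<^sup>2 + int (tri k)))"
    using admissible_theta[of 1] admissible_theta[of 5] by simp_all
  note mult = genfun_mult_UNIV[OF adm(2) adm(4)] genfun_mult_UNIV[OF adm(1) adm(5)] genfun_mult_UNIV[OF adm(3) adm(6)]
  define G where "G w = genfun (UNIV :: (int \<times> int) set) w (\<lambda>_. 1)" for w
  \<comment> \<open>\<open>e\<close> and \<open>o'\<close> are the weights that occur twice in the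
    first and in the second product; \<open>c\<close> is the one they share.\<close>
  define e where "e = (\<lambda>(j::int, l::int). 9 * j\<^sup>2 - 6 * j * l + 6 * l\<^sup>2 + 3 * j - l)"
  define o' where "o' = (\<lambda>(j::int, l::int). 9 * j\<^sup>2 - 6 * j * l + 6 * l\<^sup>2 + 5 * l + 1)"
  define c where "c = (\<lambda>(j::int, l::int). (3 * j + 1 - l)\<^sup>2 + (3 * j + 1 - l) + 5 * l\<^sup>2)"
  have "theta2 1 * theta3 5 = G e + G c + G e"
    unfolding theta2_def theta3_def of_nat_1 of_nat_numeral mult_1 mult(1) genfun_mod3_split[OF mult(2)] G_def
  proof (intro arg_cong2[of _ _ _ _ "(+)"], goal_cases)
    \<comment> \<open>In the original variables this is k -> -1-k, l -> -l, which exchanges the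
      residues 0 and 2 of k + l.\<close>
    case 3
    show ?case by (rule genfun_reindex[of _ "\<lambda>(j, l). (- j - 1, - l)" _ "\<lambda>(j, l). (- j - 1, - l)"])
       (auto simp: e_def algebra_simps power2_eq_square)
  qed (rule genfun_cong; auto simp: e_def c_def algebra_simps power2_eq_square)+
  moreover have "fps_X * (theta3 1 * theta2 5) = G o' + G c + G o'"
  proof -
    have "fps_X * (theta3 1 * theta2 5) = fps_X ^ 1 * (theta3 1 * theta2 5)" by simp
    also have "\<dots> = genfun UNIV (\<lambda>p. (case p of (k, l) \<Rightarrow> k\<^sup>2 + 5 * (l\<^sup>2 + l)) + 1) (\<lambda>(k, l). 1 * 1)"
      unfolding theta2_def theta3_def of_nat_1 of_nat_numeral mult_1 mult(3) genfun_shift[OF mult(4)] ..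
    finally have *: "fps_X * (theta3 1 * theta2 5) = genfun UNIV (\<lambda>p. (case p of (k, l) \<Rightarrow> k\<^sup>2 + 5 * (l\<^sup>2 + l)) + 1) (\<lambda>(k, l). 1 * 1)" .
    have adm': "admissible UNIV (\<lambda>p. (case p of (k, l) \<Rightarrow> k\<^sup>2 + 5 * (l\<^sup>2 + l)) + 1)"
      using mult(4) unfolding admissible_def by (auto simp: eq_diff_eq[symmetric])
    show ?thesis unfolding * genfun_mod3_split[OF adm'] G_def
    proof (intro arg_cong2[of _ _ _ _ "(+)"], goal_cases)
      \<comment> \<open>This is X -> -X with Y fixed; it carries the middle class of the second
        product onto that of the first.\<close>
      case 2
      show ?case by (rule genfun_reindex[of _ "\<lambda>(j, l). (j, j - l)" _ "\<lambda>(j, l). (j, j - l)"])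
         (auto simp: c_def algebra_simps power2_eq_square)
    next
      case 3
      show ?case by (rule genfun_reindex[of _ "\<lambda>(j, l). (- j - 1, - l - 1)" _ "\<lambda>(j, l). (- j - 1, - l - 1)"])
         (auto simp: o'_def algebra_simps power2_eq_square)
    qed (rule genfun_cong; auto simp: o'_def c_def algebra_simps power2_eq_square)+
  qed
  \<comment> \<open>The product of the signs is constant on each parity class: plus on the even
    class, of weight \<open>e\<close>, and minus on the odd class, of weight
    \<open>o'\<close>.\<close>
  moreover have "pentagonal 1 * pentagonal 5 = G e - G o'"
    unfolding diff_conv_add_uminus G_def genfun_uminus[symmetric]
    unfolding pentagonal_def of_nat_1 of_nat_numeral mult_1 mult(5) genfun_parity_split'[OF mult(6)]
  proof (intro arg_cong2[of _ _ _ _ "(+)"] genfun_cong, goal_cases)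
    case (1 x)
    obtain j l where x: "x = (j, l)" by force
    show ?case using int_tri[of j] int_tri[of "j - 2 * l"]
      by (simp add: x e_def algebra_simps power2_eq_square)
  next
    case (3 x)
    obtain j l where x: "x = (j, l)" by force
    show ?case using int_tri[of j] int_tri[of "j - 2 * l - 1"]
      by (simp add: x o'_def algebra_simps power2_eq_square)
  qed auto
  ultimately show ?thesis by (simp only:) (simp add: algebra_simps)
qed

section \<open>The modular equation of degree 5\<close>

text \<open>x_d and y_d are \<open>odd_prod 1 d\<close> and \<open>odd_prod (- 1) d\<close>, and c_d
  is \<open>even_prod 1 d\<close>. The remaining product \<open>even_prod (- 1) d\<close> is a
  common factor of the theta series and cancels in the end.\<close>

definition odd_prod :: "real \<Rightarrow> nat \<Rightarrow> real fps" where
  "odd_prod c d = infprod_fps (\<lambda>i. 1 + fps_const c * fps_X ^ (d * (2 * i + 1)))"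

definition even_prod :: "real \<Rightarrow> nat \<Rightarrow> real fps" where
  "even_prod c d = infprod_fps (\<lambda>i. 1 + fps_const c * fps_X ^ (d * (2 * i + 2)))"

lemma X_power_dvd_monom:
  assumes "i < f"
  shows "fps_X ^ Suc i dvd (1 + fps_const c * fps_X ^ f) - (1 :: real fps)"
proof -
  have "fps_X ^ Suc i dvd (fps_X ^ f :: real fps)" using assms by (intro le_imp_power_dvd) simp
  then show ?thesis by (simp del: power_Suc)
qed

lemma less_mult_posI: "0 < d \<Longrightarrow> i < j \<Longrightarrow> i < d * j" for d i j :: nat
  by (metis One_nat_def Suc_leI less_le_trans mult.commute mult.right_neutral mult_le_mono2)

lemma tendsto_odd_prod:
  "d > 0 \<Longrightarrow> (\<lambda>m. \<Prod>i<m. 1 + fps_const c * fps_X ^ (d * (2 * i + 1))) \<longlonglongrightarrow> odd_prod c d"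
  unfolding odd_prod_def by (intro tendsto_infprod_fps X_power_dvd_monom less_mult_posI) auto

lemma tendsto_even_prod:
  "d > 0 \<Longrightarrow> (\<lambda>m. \<Prod>i<m. 1 + fps_const c * fps_X ^ (d * (2 * i + 2))) \<longlonglongrightarrow> even_prod c d"
  unfolding even_prod_def by (intro tendsto_infprod_fps X_power_dvd_monom less_mult_posI) auto

lemma odd_prod_nth_0: "d > 0 \<Longrightarrow> odd_prod c d $ 0 = 1"
  by (simp add: odd_prod_def infprod_fps_def)

lemma even_prod_nth_0: "d > 0 \<Longrightarrow> even_prod c d $ 0 = 1"
  by (simp add: even_prod_def infprod_fps_def)

section \<open>Product formulas for the theta series\<close>

lemma int_tri_add: "int (tri k + tri (- k)) = k\<^sup>2"
  using int_tri[of k] int_tri[of "- k"] by (simp add: algebra_simps power2_eq_square)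

lemma minus_one_power_tri: "(- 1 :: real) ^ (tri k + tri (- k)) = parity_sign k"
proof -
  have "even (int (tri k + tri (- k))) \<longleftrightarrow> even k" unfolding int_tri_add by simp
  then have "even (tri k + tri (- k)) \<longleftrightarrow> even k" by presburger
  then show ?thesis by (simp only: minus_one_power_iff)
qed

text \<open>Since c^2 = 1, the product ab is a pure power of X; the factors are brought into the
  shape used by \<open>odd_prod\<close> and \<open>even_prod\<close>.\<close>

lemma triple_product_monom:
  fixes c :: real
  assumes "\<alpha> + \<beta> > 0" "c\<^sup>2 = 1"
  shows "(\<lambda>m. \<Prod>i<m. (1 + fps_const c * fps_X ^ (\<alpha> + (\<alpha> + \<beta>) * i)) * (1 + fps_const c * fps_X ^ (\<beta> + (\<alpha> + \<beta>) * i)) *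
      (1 + fps_const (- 1) * fps_X ^ ((\<alpha> + \<beta>) * Suc i)))
    \<longlonglongrightarrow> genfun UNIV (\<lambda>k. int (\<alpha> * tri k + \<beta> * tri (- k))) (\<lambda>k. c ^ (tri k + tri (- k)))"
proof -
  have "fps_const c * fps_X ^ \<alpha> * (fps_const c * fps_X ^ \<beta>) = fps_const (c\<^sup>2) * fps_X ^ (\<alpha> + \<beta>)"
    by (simp add: power_add power2_eq_square mult_ac flip: fps_const_mult)
  then have Q: "fps_const c * fps_X ^ \<alpha> * (fps_const c * fps_X ^ \<beta>) = fps_X ^ (\<alpha> + \<beta>)"
    using assms(2) by simp
  show ?thesis
    using triple_product[OF assms(1), of c]
    unfolding Q unfolding power_mult[symmetric] mult.assoc power_add[symmetric]
    by (simp only: fps_const_neg[symmetric] fps_const_1_eq_1 minus_mult_minus mult_minus_left mult_1 add_uminus_conv_diff)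
qed

text \<open>The triple product with both exponents d and c = 1; with c = -1 it gives
  \<open>theta4\<close>.\<close>

lemma theta3_eq_prod:
  assumes "d > 0"
  shows "theta3 d = odd_prod 1 d * odd_prod 1 d * even_prod (- 1) d"
proof (rule LIMSEQ_unique)
  have e: "d + (d + d) * i = d * (2 * i + 1)" "(d + d) * Suc i = d * (2 * i + 2)" for i
    by (auto simp: algebra_simps)
  have "genfun UNIV (\<lambda>k. int (d * tri k + d * tri (- k))) (\<lambda>k. 1 ^ (tri k + tri (- k))) = theta3 d"
    unfolding theta3_def distrib_left[symmetric] by (rule genfun_cong) (simp_all only: of_nat_mult int_tri_add power_one)
  then show "(\<lambda>m. \<Prod>i<m. (1 + fps_const 1 * fps_X ^ (d * (2 * i + 1))) * (1 + fps_const 1 * fps_X ^ (d * (2 * i + 1))) *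
    (1 + fps_const (- 1) * fps_X ^ (d * (2 * i + 2)))) \<longlonglongrightarrow> theta3 d"
    using triple_product_monom[of d d 1] assms unfolding e by simp
qed (unfold prod.distrib, intro tendsto_mult_fps tendsto_odd_prod tendsto_even_prod assms)

lemma theta4_eq_prod:
  assumes "d > 0"
  shows "theta4 d = odd_prod (- 1) d * odd_prod (- 1) d * even_prod (- 1) d"
proof (rule LIMSEQ_unique)
  have e: "d + (d + d) * i = d * (2 * i + 1)" "(d + d) * Suc i = d * (2 * i + 2)" for i
    by (auto simp: algebra_simps)
  have "genfun UNIV (\<lambda>k. int (d * tri k + d * tri (- k))) (\<lambda>k. (- 1) ^ (tri k + tri (- k))) = theta4 d"
    unfolding theta4_def distrib_left[symmetric] by (rule genfun_cong) (simp_all only: of_nat_mult int_tri_add minus_one_power_tri)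
  then show "(\<lambda>m. \<Prod>i<m. (1 + fps_const (- 1) * fps_X ^ (d * (2 * i + 1))) * (1 + fps_const (- 1) * fps_X ^ (d * (2 * i + 1))) *
    (1 + fps_const (- 1) * fps_X ^ (d * (2 * i + 2)))) \<longlonglongrightarrow> theta4 d"
    using triple_product_monom[of d d "- 1"] assms unfolding e by simp
qed (unfold prod.distrib, intro tendsto_mult_fps tendsto_odd_prod tendsto_even_prod assms)

text \<open>The triple product with exponents 2d and 0.\<close>

lemma theta2_eq_prod:
  assumes "d > 0"
  shows "theta2 d = even_prod 1 d * (2 * even_prod 1 d) * even_prod (- 1) d"
proof (rule LIMSEQ_unique)
  have e: "2 * d + (2 * d + 0) * i = d * (2 * i + 2)" "0 + (2 * d + 0) * i = d * (2 * i)" "(2 * d + 0) * Suc i = d * (2 * i + 2)" for i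
    by (auto simp: algebra_simps)
  have "genfun UNIV (\<lambda>k. int (2 * d * tri k + 0 * tri (- k))) (\<lambda>k. 1 ^ (tri k + tri (- k))) = theta2 d"
    unfolding theta2_def
  proof (rule genfun_cong, goal_cases)
    case (1 k)
    have "int (2 * d * tri k + 0 * tri (- k)) = int d * (2 * int (tri k))" by simp
    then show ?case unfolding int_tri by (simp add: power2_eq_square algebra_simps)
  qed simp
  then show "(\<lambda>m. \<Prod>i<m. (1 + fps_const 1 * fps_X ^ (d * (2 * i + 2))) * (1 + fps_X ^ (d * (2 * i))) *
    (1 + fps_const (- 1) * fps_X ^ (d * (2 * i + 2)))) \<longlonglongrightarrow> theta2 d"
    using triple_product_monom[of "2 * d" 0 1] assms unfolding e by simp
next
  \<comment> \<open>The factor for i = 0 is 2; the others are those of \<open>even_prod 1 d\<close>,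
    with the index shifted by one.\<close>
  have "(\<lambda>m. \<Prod>i<Suc m. 1 + fps_X ^ (d * (2 * i))) \<longlonglongrightarrow> 2 * even_prod 1 d"
    unfolding prod.lessThan_Suc_shift
    using tendsto_mult_fps[OF tendsto_const[of 2] tendsto_even_prod[OF assms, of 1]] by simp
  then have "(\<lambda>m. \<Prod>i<m. 1 + fps_X ^ (d * (2 * i))) \<longlonglongrightarrow> 2 * even_prod 1 d"
    by (rule LIMSEQ_imp_Suc)
  then show "(\<lambda>m. \<Prod>i<m. (1 + fps_const 1 * fps_X ^ (d * (2 * i + 2))) * (1 + fps_X ^ (d * (2 * i))) *
    (1 + fps_const (- 1) * fps_X ^ (d * (2 * i + 2)))) \<longlonglongrightarrow> even_prod 1 d * (2 * even_prod 1 d) * even_prod (- 1) d"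
    unfolding prod.distrib by (intro tendsto_mult_fps tendsto_even_prod assms)
qed

lemma prod_lessThan_multiples:
  fixes f :: "nat \<Rightarrow> 'a :: comm_monoid_mult"
  shows "(\<Prod>i<m. f (2 * i) * f (2 * i + 1)) = (\<Prod>j<2 * m. f j)"
    and "(\<Prod>i<m. f (3 * i + 1) * f (3 * i) * f (3 * i + 2)) = (\<Prod>j<3 * m. f j)"
proof -
  show "(\<Prod>i<m. f (2 * i) * f (2 * i + 1)) = (\<Prod>j<2 * m. f j)"
    by (induction m) (simp_all add: mult_ac)
  show "(\<Prod>i<m. f (3 * i + 1) * f (3 * i) * f (3 * i + 2)) = (\<Prod>j<3 * m. f j)"
    by (induction m) (simp_all add: mult_ac numeral_3_eq_3)
qed

lemma tendsto_mult_index: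
  fixes k :: nat
  assumes "f \<longlonglongrightarrow> l" "k > 0"
  shows "(\<lambda>m. f (k * m)) \<longlonglongrightarrow> l"
  using LIMSEQ_subseq_LIMSEQ[OF assms(1), of "\<lambda>m. k * m"] assms(2) by (simp add: strict_mono_def comp_def)

text \<open>The triple product with exponents 2d and d runs through the factors 1 - q^(dn) three at
  a time, by residue of n modulo 3; the right side takes them two at a time, by parity. Both have
  the limit of the full product.\<close>

lemma pentagonal_eq_prod:
  assumes "d > 0"
  shows "pentagonal d = odd_prod (- 1) d * even_prod (- 1) d"
proof -
  define f where "f j = 1 + fps_const (- 1) * (fps_X :: real fps) ^ (d * Suc j)" for j
  define l where "l = infprod_fps f"
  have "(\<lambda>m. \<Prod>j<m. f j) \<longlonglongrightarrow> l"
    unfolding l_def f_def by (intro tendsto_infprod_fps X_power_dvd_monom less_mult_posI assms) auto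
  then have lim: "(\<lambda>m. \<Prod>j<k * m. f j) \<longlonglongrightarrow> l" if "k > 0" for k
    using tendsto_mult_index[of "\<lambda>m. \<Prod>j<m. f j"] that by blast
  have e: "2 * d + (2 * d + d) * i = d * Suc (3 * i + 1)" "d + (2 * d + d) * i = d * Suc (3 * i)" "(2 * d + d) * Suc i = d * Suc (3 * i + 2)" for i
    by (auto simp: algebra_simps)
  have "genfun UNIV (\<lambda>k. int (2 * d * tri k + d * tri (- k))) (\<lambda>k. (- 1) ^ (tri k + tri (- k))) = pentagonal d"
    unfolding pentagonal_def
  proof (rule genfun_cong, goal_cases)
    case (1 k)
    have "int (2 * d * tri k + d * tri (- k)) = int d * (int (tri k + tri (- k)) + int (tri k))"
      by (simp add: algebra_simps)
    then show ?case unfolding int_tri_add .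
  qed (rule minus_one_power_tri)
  then have "(\<lambda>m. \<Prod>i<m. f (3 * i + 1) * f (3 * i) * f (3 * i + 2)) \<longlonglongrightarrow> pentagonal d"
    using triple_product_monom[of "2 * d" d "- 1"] assms unfolding f_def e by simp
  then have 1: "pentagonal d = l"
    using lim[of 3] unfolding prod_lessThan_multiples by (auto intro: LIMSEQ_unique)
  have "(\<lambda>m. \<Prod>i<m. f (2 * i) * f (2 * i + 1)) \<longlonglongrightarrow> odd_prod (- 1) d * even_prod (- 1) d"
    using tendsto_mult_fps[OF tendsto_odd_prod[OF assms] tendsto_even_prod[OF assms], of "- 1" "- 1"]
    unfolding f_def prod.distrib by simp
  then have "odd_prod (- 1) d * even_prod (- 1) d = l"
    using lim[of 2] unfolding prod_lessThan_multiples by (auto intro: LIMSEQ_unique)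
  with 1 show ?thesis by simp
qed

text \<open>Multiplying (1 + Q^j)(1 - Q^j) = 1 - Q^(2j) over all j gives
  \<open>even_prod (- 1) d\<close>, which also occurs on the left and cancels, having constant term
  1.\<close>

lemma euler_prod:
  assumes "d > 0"
  shows "odd_prod 1 d * odd_prod (- 1) d * even_prod 1 d = 1"
proof -
  define f where "f j = 1 + fps_const (- 1) * (fps_X :: real fps) ^ (d * (2 * j + 2))" for j
  have "(\<lambda>m. \<Prod>i<m. ((1 + fps_const 1 * fps_X ^ (d * (2 * i + 1))) * (1 + fps_const (- 1) * fps_X ^ (d * (2 * i + 1)))) *
    ((1 + fps_const 1 * fps_X ^ (d * (2 * i + 2))) * (1 + fps_const (- 1) * fps_X ^ (d * (2 * i + 2)))))
    \<longlonglongrightarrow> (odd_prod 1 d * odd_prod (- 1) d) * (even_prod 1 d * even_prod (- 1) d)" (is "?F \<longlonglongrightarrow> _")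
    unfolding prod.distrib by (intro tendsto_mult_fps tendsto_odd_prod tendsto_even_prod assms)
  also have "?F = (\<lambda>m. \<Prod>i<m. f (2 * i) * f (2 * i + 1))"
    unfolding f_def by (intro ext prod.cong arg_cong2[of _ _ _ _ "(*)"])
      (simp_all add: algebra_simps flip: fps_const_neg power_add)
  also have "\<dots> = (\<lambda>m. \<Prod>j<2 * m. f j)"
    unfolding prod_lessThan_multiples ..
  finally have "(\<lambda>m. \<Prod>j<2 * m. f j) \<longlonglongrightarrow> (odd_prod 1 d * odd_prod (- 1) d) * (even_prod 1 d * even_prod (- 1) d)" .
  moreover have "(\<lambda>m. \<Prod>j<2 * m. f j) \<longlonglongrightarrow> even_prod (- 1) d"
    unfolding f_def by (rule tendsto_mult_index[OF tendsto_even_prod[OF assms]]) simp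
  ultimately have "(odd_prod 1 d * odd_prod (- 1) d * even_prod 1 d) * even_prod (- 1) d = 1 * even_prod (- 1) d"
    by (metis LIMSEQ_unique mult.assoc mult_1)
  moreover have "even_prod (- 1) d \<noteq> 0" using even_prod_nth_0[OF assms, of "- 1"] by auto
  ultimately show ?thesis using mult_right_cancel by blast
qed

text \<open>The mixed terms form the symmetric expression U^4 + (qV)^4, which is determined by U -
  qV = w and UV = v^2. The Euler relations give vw = 1, so that both sides become perfect
  squares.\<close>

lemma quintic_algebra:
  fixes q :: "'a :: idom"
  assumes e1: "x1 * y1 * c1 = 1" and e5: "x5 * y5 * c5 = 1"
    and j1: "x1 ^ 8 = y1 ^ 8 + 16 * q * c1 ^ 8" and j5: "x5 ^ 8 = y5 ^ 8 + 16 * q ^ 5 * c5 ^ 8"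
    and t: "c1\<^sup>2 * x5\<^sup>2 - q * (x1\<^sup>2 * c5\<^sup>2) = y1 * y5"
  shows "((y1 * y5) ^ 4 + 8 * q)\<^sup>2 = ((x1 * x5) ^ 4 - 16 * q ^ 3 * (c1 * c5) ^ 4)\<^sup>2"
proof -
  define w v U V where "w = y1 * y5" and "v = x1 * x5 * (c1 * c5)" and "U = c1\<^sup>2 * x5\<^sup>2" and "V = x1\<^sup>2 * c5\<^sup>2"
  have vw: "v * w = 1"
  proof -
    have "v * w = (x1 * y1 * c1) * (x5 * y5 * c5)" by (simp add: v_def w_def mult_ac)
    then show ?thesis by (simp add: e1 e5)
  qed
  have UV: "U * V = v\<^sup>2" by (simp add: U_def V_def v_def power_mult_distrib mult_ac)
  have "(U - q * V)\<^sup>2 = w\<^sup>2" using t by (simp add: U_def V_def w_def)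
  then have "U\<^sup>2 + q\<^sup>2 * V\<^sup>2 = w\<^sup>2 + 2 * q * (U * V)" by (simp add: algebra_simps power2_eq_square)
  then have s: "U\<^sup>2 + q\<^sup>2 * V\<^sup>2 = w\<^sup>2 + 2 * q * v\<^sup>2" by (simp only: UV)
  have "U ^ 4 + q ^ 4 * V ^ 4 = (U\<^sup>2 + q\<^sup>2 * V\<^sup>2)\<^sup>2 - 2 * q\<^sup>2 * (U * V)\<^sup>2"
    by algebra
  also have "\<dots> = w ^ 4 + 4 * q * (v * w)\<^sup>2 + 2 * q\<^sup>2 * v ^ 4"
    unfolding s UV by algebra
  finally have UV4: "U ^ 4 + q ^ 4 * V ^ 4 = w ^ 4 + 4 * q + 2 * q\<^sup>2 * v ^ 4" by (simp add: vw)
  have "w ^ 8 = (x1 ^ 8 - 16 * q * c1 ^ 8) * (x5 ^ 8 - 16 * q ^ 5 * c5 ^ 8)"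
    by (simp add: j1 j5 w_def power_mult_distrib)
  \<comment> \<open>The mixed terms are c1^8 x5^8 = U^4 and x1^8 c5^8 = V^4.\<close>
  also have "\<dots> = (x1 * x5) ^ 8 + 256 * q ^ 6 * (c1 * c5) ^ 8 - 16 * q * (U ^ 4 + q ^ 4 * V ^ 4)"
    unfolding U_def V_def by algebra
  also have "\<dots> = (x1 * x5) ^ 8 + 256 * q ^ 6 * (c1 * c5) ^ 8 - 32 * q ^ 3 * v ^ 4 - 16 * q * w ^ 4 - 64 * q\<^sup>2"
    unfolding UV4 by algebra
  finally have "w ^ 8 + 16 * q * w ^ 4 + 64 * q\<^sup>2 = (x1 * x5) ^ 8 + 256 * q ^ 6 * (c1 * c5) ^ 8 - 32 * q ^ 3 * v ^ 4"
    by simp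
  moreover have "(w ^ 4 + 8 * q)\<^sup>2 = w ^ 8 + 16 * q * w ^ 4 + 64 * q\<^sup>2" by algebra
  moreover have "((x1 * x5) ^ 4 - 16 * q ^ 3 * (c1 * c5) ^ 4)\<^sup>2 = (x1 * x5) ^ 8 + 256 * q ^ 6 * (c1 * c5) ^ 8 - 32 * q ^ 3 * v ^ 4"
    unfolding v_def by algebra
  ultimately show ?thesis unfolding w_def by simp
qed

text \<open>In product form, Jacobi's identity carries the factor e_d^4 and the quintic one the
  factor 2 e_1 e_5. Both are nonzero in an integral domain and cancel, which leaves the hypotheses
  of the elimination.\<close>

theorem quintic_product_identity:
  "odd_prod 1 1 ^ 4 * odd_prod 1 5 ^ 4 - odd_prod (- 1) 1 ^ 4 * odd_prod (- 1) 5 ^ 4 =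
   8 * fps_X + 16 * fps_X ^ 3 * (even_prod 1 1 ^ 4 * even_prod 1 5 ^ 4)"
proof -
  define x y c e where "x = odd_prod 1" and "y = odd_prod (- 1)" and "c = even_prod 1" and "e = even_prod (- 1)"
  note defs = x_def y_def c_def e_def
  have e0: "e d \<noteq> 0" if "d > 0" for d using even_prod_nth_0[OF that, of "- 1"] by (auto simp: e_def)
  have euler: "x d * y d * c d = 1" if "d > 0" for d using euler_prod[OF that] by (simp add: defs)
  have th: "theta3 d = x d * x d * e d" "theta4 d = y d * y d * e d" "theta2 d = c d * (2 * c d) * e d"
    "pentagonal d = y d * e d" if "d > 0" for d
    using theta3_eq_prod[OF that] theta4_eq_prod[OF that] theta2_eq_prod[OF that] pentagonal_eq_prod[OF that]
    by (simp_all add: defs)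
  have quartic: "x d ^ 8 = y d ^ 8 + 16 * fps_X ^ d * c d ^ 8" if "d > 0" for d
  proof -
    have "e d ^ 4 * x d ^ 8 = theta3 d ^ 4" unfolding th[OF that] by algebra
    also have "\<dots> = theta4 d ^ 4 + fps_X ^ d * theta2 d ^ 4" by (rule jacobi_quartic[OF that])
    also have "\<dots> = e d ^ 4 * (y d ^ 8 + 16 * fps_X ^ d * c d ^ 8)" unfolding th[OF that] by algebra
    finally show ?thesis using e0[OF that] mult_left_cancel[of "e d ^ 4"] by simp
  qed
  have "2 * (e 1 * e 5) * ((c 1)\<^sup>2 * (x 5)\<^sup>2 - fps_X * ((x 1)\<^sup>2 * (c 5)\<^sup>2)) =
      theta2 1 * theta3 5 - fps_X * (theta3 1 * theta2 5)"
    by (simp add: th algebra_simps power2_eq_square)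
  also have "\<dots> = 2 * (e 1 * e 5) * (y 1 * y 5)"
    unfolding theta_quintic by (simp add: th algebra_simps)
  finally have quintic: "(c 1)\<^sup>2 * (x 5)\<^sup>2 - fps_X * ((x 1)\<^sup>2 * (c 5)\<^sup>2) = y 1 * y 5"
    using e0[of 1] e0[of 5] by (subst (asm) mult_left_cancel) auto
  have "((y 1 * y 5) ^ 4 + 8 * fps_X)\<^sup>2 = ((x 1 * x 5) ^ 4 - 16 * fps_X ^ 3 * (c 1 * c 5) ^ 4)\<^sup>2"
    using quintic_algebra[OF euler euler _ quartic quintic] quartic[of 1] by simp
  then have "(y 1 * y 5) ^ 4 + 8 * fps_X = (x 1 * x 5) ^ 4 - 16 * fps_X ^ 3 * (c 1 * c 5) ^ 4 \<or>
    (y 1 * y 5) ^ 4 + 8 * fps_X = - ((x 1 * x 5) ^ 4 - 16 * fps_X ^ 3 * (c 1 * c 5) ^ 4)"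
    by (simp only: power2_eq_iff)
  \<comment> \<open>The constant terms of the two sides are 1 and -1.\<close>
  moreover have "(y 1 * y 5) ^ 4 + 8 * fps_X \<noteq> - ((x 1 * x 5) ^ 4 - 16 * fps_X ^ 3 * (c 1 * c 5) ^ 4)"
  proof
    assume "(y 1 * y 5) ^ 4 + 8 * fps_X = - ((x 1 * x 5) ^ 4 - 16 * fps_X ^ 3 * (c 1 * c 5) ^ 4)"
    then have "((y 1 * y 5) ^ 4 + 8 * fps_X) $ 0 = (- ((x 1 * x 5) ^ 4 - 16 * fps_X ^ 3 * (c 1 * c 5) ^ 4)) $ 0"
      by simp
    then show False by (simp add: defs odd_prod_nth_0 even_prod_nth_0 fps_power_zeroth)
  qed
  ultimately show ?thesis by (simp add: defs power_mult_distrib algebra_simps)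
qed

section \<open>Partitions into distinct elements\<close>

text \<open>Expansion over subsets. The variable c marks the number of parts: 1 counts all of them,
  -1 counts with the sign of the parity.\<close>

lemma prod_one_plus_monom_nth:
  fixes c :: real
  assumes "finite E"
  shows "(\<Prod>x\<in>E. 1 + fps_const c * fps_X ^ fst x) $ N = (\<Sum>P | P \<subseteq> E \<and> (\<Sum>x\<in>P. fst x) = N. c ^ card P)"
proof -
  have "(\<Prod>x\<in>E. 1 + fps_const c * fps_X ^ fst x) = (\<Prod>x\<in>E. fps_const c * fps_X ^ fst x + 1)"
    by (simp add: add.commute)
  also have "\<dots> = (\<Sum>P\<in>Pow E. \<Prod>x\<in>P. fps_const c * fps_X ^ fst x)"
    using prod_add[OF assms, of "\<lambda>x. fps_const c * fps_X ^ fst x" "\<lambda>_. 1"] by simp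
  also have "\<dots> = (\<Sum>P\<in>Pow E. fps_const (c ^ card P) * fps_X ^ (\<Sum>x\<in>P. fst x))"
    by (simp add: prod.distrib power_sum)
  finally have "(\<Prod>x\<in>E. 1 + fps_const c * fps_X ^ fst x) $ N =
      (\<Sum>P\<in>Pow E. if (\<Sum>x\<in>P. fst x) = N then c ^ card P else 0)"
    by (auto simp: fps_sum_nth intro!: sum.cong)
  also have "\<dots> = (\<Sum>P | P \<in> Pow E \<and> (\<Sum>x\<in>P. fst x) = N. c ^ card P)"
    by (rule sum.inter_filter[symmetric]) (use assms in simp)
  finally show ?thesis by simp
qed

lemma tendsto_power_fps:
  fixes f :: "'b \<Rightarrow> 'a :: comm_ring_1 fps"
  assumes "(f \<longlongrightarrow> a) F"
  shows "((\<lambda>x. f x ^ n) \<longlongrightarrow> a ^ n) F"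
  by (induction n) (auto intro: tendsto_mult_fps assms)

definition copies :: "(nat \<Rightarrow> nat) \<Rightarrow> (nat \<times> nat) set" where
  "copies g = {(n, j). n \<in> range g \<and> (j < 4 \<or> 5 dvd n \<and> j < 8)}"

text \<open>The copies 4 to 7 are indexed by n/5 instead of n, so that the product over this set has
  the shape of the products for d = 1 and d = 5.\<close>

definition copies_upto :: "(nat \<Rightarrow> nat) \<Rightarrow> nat \<Rightarrow> (nat \<times> nat) set" where
  "copies_upto g m = (\<lambda>(i, j). (g i, j)) ` ({..<m} \<times> {..<4}) \<union> (\<lambda>(i, j). (5 * g i, j)) ` ({..<m} \<times> {4..<8})"

lemma prod_copies_upto:
  fixes f :: "nat \<Rightarrow> 'a :: comm_semiring_1"
  assumes "inj g"
  shows "(\<Prod>x\<in>copies_upto g m. f (fst x)) = (\<Prod>i<m. f (g i)) ^ 4 * (\<Prod>i<m. f (5 * g i)) ^ 4"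
proof -
  have *: "(\<Prod>x\<in>(\<lambda>(i, j). (h i, j)) ` ({..<m} \<times> J). f (fst x)) = (\<Prod>i<m. f (h i)) ^ card J" if "inj h" for h and J :: "nat set"
  proof -
    have "inj_on (\<lambda>(i, j). (h i, j)) ({..<m} \<times> J)" using that by (auto simp: inj_on_def)
    then have "(\<Prod>x\<in>(\<lambda>(i, j). (h i, j)) ` ({..<m} \<times> J). f (fst x)) = (\<Prod>(i, j)\<in>{..<m} \<times> J. f (h i))"
      by (subst prod.reindex) (auto intro!: prod.cong)
    also have "\<dots> = (\<Prod>i<m. f (h i) ^ card J)"
      by (subst prod.cartesian_product[symmetric]) simp
    finally show ?thesis by (simp add: prod_power_distrib)
  qed
  have "inj (\<lambda>i. 5 * g i)" using assms by (auto simp: inj_def)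
  then show ?thesis unfolding copies_upto_def
    using *[OF assms, of "{..<4}"] *[of "\<lambda>i. 5 * g i" "{4..<8}"]
    by (subst prod.union_disjoint) auto
qed

lemma finite_copies_upto: "finite (copies_upto g m)"
  by (simp add: copies_upto_def)

text \<open>No part exceeds N, so g i >= i bounds its index below m. Closure of the range under
  multiplication and division by 5 matches the additional copies.\<close>

lemma distinct_partitions_copies:
  assumes "\<And>i. i \<le> g i" and five: "\<And>n. 5 * n \<in> range g \<longleftrightarrow> n \<in> range g" and "N < m"
  shows "distinct_partitions (copies g) N = {P. P \<subseteq> copies_upto g m \<and> (\<Sum>x\<in>P. fst x) = N}"
proof (intro equalityI subsetI)
  fix P assume "P \<in> {P. P \<subseteq> copies_upto g m \<and> (\<Sum>x\<in>P. fst x) = N}"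
  moreover have "copies_upto g m \<subseteq> copies g"
    using five by (auto simp: copies_def copies_upto_def)
  ultimately show "P \<in> distinct_partitions (copies g) N"
    using finite_copies_upto[of g m] by (auto simp: distinct_partitions_def intro: finite_subset)
next
  fix P assume P: "P \<in> distinct_partitions (copies g) N"
  have "x \<in> copies_upto g m" if x: "x \<in> P" for x
  proof -
    obtain n j where nj: "x = (n, j)" by force
    have "n \<le> N" using P x member_le_sum[of x P fst] by (auto simp: distinct_partitions_def nj)
    have "n \<in> range g" and j: "j < 4 \<or> 5 dvd n \<and> j < 8"
      using P x by (auto simp: distinct_partitions_def copies_def nj)
    show ?thesis
    proof (cases "j < 4")
      case True
      from \<open>n \<in> range g\<close> obtain i where "n = g i" by auto
      moreover have "i < m" using assms(1)[of i] \<open>n \<le> N\<close> \<open>N < m\<close> \<open>n = g i\<close> by simp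
      ultimately show ?thesis using True by (auto simp: nj copies_upto_def)
    next
      case False
      with j obtain n' where n': "n = 5 * n'" by auto
      with five \<open>n \<in> range g\<close> obtain i where "n' = g i" by auto
      moreover have "i < m" using assms(1)[of i] \<open>n \<le> N\<close> \<open>N < m\<close> \<open>n' = g i\<close> n' by simp
      ultimately show ?thesis using False j n' by (auto simp: nj copies_upto_def image_iff)
    qed
  qed
  then show "P \<in> {P. P \<subseteq> copies_upto g m \<and> (\<Sum>x\<in>P. fst x) = N}"
    using P by (auto simp: distinct_partitions_def)
qed

text \<open>Coefficient N of the truncated product equals the left side for every m > N, and the
  right side for all large m.\<close>

lemma sum_distinct_partitions_copies:
  fixes c :: real
  assumes g: "\<And>i. i \<le> g i" "inj g" "\<And>n. 5 * n \<in> range g \<longleftrightarrow> n \<in> range g"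
    and A: "(\<lambda>m. \<Prod>i<m. 1 + fps_const c * fps_X ^ g i) \<longlonglongrightarrow> A"
    and B: "(\<lambda>m. \<Prod>i<m. 1 + fps_const c * fps_X ^ (5 * g i)) \<longlonglongrightarrow> B"
  shows "(\<Sum>P\<in>distinct_partitions (copies g) N. c ^ card P) = (A ^ 4 * B ^ 4) $ N"
proof -
  have "(\<lambda>m. (\<Prod>i<m. 1 + fps_const c * fps_X ^ g i) ^ 4 * (\<Prod>i<m. 1 + fps_const c * fps_X ^ (5 * g i)) ^ 4)
     \<longlonglongrightarrow> A ^ 4 * B ^ 4"
    by (intro tendsto_mult_fps tendsto_power_fps A B)
  then have "eventually (\<lambda>m. ((\<Prod>i<m. 1 + fps_const c * fps_X ^ g i) ^ 4 * (\<Prod>i<m. 1 + fps_const c * fps_X ^ (5 * g i)) ^ 4) $ N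
      = (A ^ 4 * B ^ 4) $ N) sequentially"
    by (simp add: tendsto_fps_iff)
  then have "eventually (\<lambda>m. (\<Sum>P\<in>distinct_partitions (copies g) N. c ^ card P) = (A ^ 4 * B ^ 4) $ N) sequentially"
    using eventually_gt_at_top[of N]
  proof eventually_elim
    case (elim m)
    show ?case
      unfolding distinct_partitions_copies[OF g(1,3) elim(2)] elim(1)[symmetric]
        prod_copies_upto[OF g(2), symmetric, where f = "\<lambda>n. 1 + fps_const c * fps_X ^ n"]
      by (rule prod_one_plus_monom_nth[OF finite_copies_upto, symmetric])
  qed
  then show ?thesis by simp
qed

lemma finite_distinct_partitions_copies:
  assumes "\<And>i. i \<le> g i" "\<And>n. 5 * n \<in> range g \<longleftrightarrow> n \<in> range g"
  shows "finite (distinct_partitions (copies g) N)"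
  unfolding distinct_partitions_copies[OF assms lessI]
  by (rule finite_subset[of _ "Pow (copies_upto g (Suc N))"]) (auto simp: finite_copies_upto)

section \<open>Specialization to odd and even parts\<close>

lemma range_odd: "n \<in> range (\<lambda>i. 2 * i + 1) \<longleftrightarrow> odd n" for n :: nat
  by (auto elim!: oddE)

lemma range_even: "n \<in> range (\<lambda>i. 2 * i + 2) \<longleftrightarrow> even n \<and> n > 0" for n :: nat
proof
  assume "even n \<and> n > 0"
  then have "n = 2 * (n div 2 - 1) + 2" by (auto elim!: evenE)
  then show "n \<in> range (\<lambda>i. 2 * i + 2)" by blast
qed auto

lemma S_elems_eq: "S_elems = copies (\<lambda>i. 2 * i + 1)"
  unfolding S_elems_def copies_def range_odd by (auto intro: odd_pos)

lemma T_elems_eq: "T_elems = copies (\<lambda>i. 2 * i + 2)"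
  unfolding T_elems_def copies_def range_even by auto

text \<open>1 - (-1)^r is 2 for odd r and 0 for even r, so the difference of the series for c = 1
  and c = -1 selects odd numbers of parts.\<close>

lemma D_S_eq: "2 * real (D_S N) =
  (odd_prod 1 1 ^ 4 * odd_prod 1 5 ^ 4 - odd_prod (- 1) 1 ^ 4 * odd_prod (- 1) 5 ^ 4) $ N"
proof -
  let ?g = "\<lambda>i::nat. 2 * i + 1" and ?D = "distinct_partitions S_elems N"
  have g: "\<And>i. i \<le> ?g i" "inj ?g" "\<And>n. 5 * n \<in> range ?g \<longleftrightarrow> n \<in> range ?g"
    unfolding range_odd by (auto simp: inj_def)
  have *: "(\<Sum>P\<in>?D. c ^ card P) = (odd_prod c 1 ^ 4 * odd_prod c 5 ^ 4) $ N" for c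
    unfolding S_elems_eq
    by (rule sum_distinct_partitions_copies[OF g]) (use tendsto_odd_prod[of 1 c] tendsto_odd_prod[of 5 c] in simp_all)
  have fin: "finite ?D" unfolding S_elems_eq by (rule finite_distinct_partitions_copies[OF g(1,3)])
  have "(\<Sum>P\<in>?D. 1 ^ card P) - (\<Sum>P\<in>?D. (- 1) ^ card P) = (\<Sum>P\<in>?D. if odd (card P) then 2 else 0 :: real)"
    unfolding sum_subtractf[symmetric] by (rule sum.cong) (auto simp: minus_one_power_iff)
  also have "\<dots> = (\<Sum>P | P \<in> ?D \<and> odd (card P). 2)"
    by (rule sum.inter_filter[OF fin, symmetric])
  also have "\<dots> = 2 * real (D_S N)"
    by (simp add: D_S_def)
  finally show ?thesis by (simp only: * fps_sub_nth)
qed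

lemma D_T_eq: "real (D_T N) = (even_prod 1 1 ^ 4 * even_prod 1 5 ^ 4) $ N"
proof -
  let ?g = "\<lambda>i::nat. 2 * i + 2"
  have g: "\<And>i. i \<le> ?g i" "inj ?g" "\<And>n. 5 * n \<in> range ?g \<longleftrightarrow> n \<in> range ?g"
    unfolding range_even by (auto simp: inj_def)
  have "(\<Sum>P\<in>distinct_partitions T_elems N. 1 ^ card P) = (even_prod 1 1 ^ 4 * even_prod 1 5 ^ 4) $ N"
    unfolding T_elems_eq
    by (rule sum_distinct_partitions_copies[OF g]) (use tendsto_even_prod[of 1 1] tendsto_even_prod[of 5 1] in simp_all)
  then show ?thesis by (simp add: D_T_def)
qed

theorem theorem3p11:
  fixes N :: nat
  assumes "N \<ge> 3"
  shows "D_S N = 8 * D_T (N - 3)"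
proof -
  have "2 * real (D_S N) = (8 * fps_X + 16 * (fps_X ^ 3 * (even_prod 1 1 ^ 4 * even_prod 1 5 ^ 4))) $ N"
    unfolding D_S_eq quintic_product_identity by (simp only: mult.assoc)
  \<comment> \<open>The term 8q contributes only at N = 1.\<close>
  also have "\<dots> = 16 * (fps_X ^ 3 * (even_prod 1 1 ^ 4 * even_prod 1 5 ^ 4)) $ N"
    using assms by (simp add: numeral_fps_const)
  also have "\<dots> = 16 * real (D_T (N - 3))"
    using assms by (simp only: fps_X_power_mult_nth D_T_eq) simp
  finally have "real (D_S N) = real (8 * D_T (N - 3))" by simp
  then show ?thesis by (simp only: of_nat_eq_iff)
qed

end
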